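(* For any $n \geq 1$ and $\chi_1,\ldots,\chi_n : (0,\infty) \to (0,\infty)$, define $\chi_{\chi_1,\ldots,\chi_n} : (0,\infty) \to (0,\infty)$ by putting, for any $\varepsilon >0$, $$\chi_{\chi_1,\ldots,\chi_n}(\varepsilon) := \min\{\chi_i(\varepsilon/n) \mid 1 \leq i \leq n\}.$$ Let $X$ be a Banach space, $n \geq 1$, $\chi_1,\ldots,\chi_n : (0,\infty) \to (0,\infty)$ and $T_1,\ldots,T_n : X \to X$ be super strongly nonexpansive with moduli $\chi_1,\ldots,\chi_n$, respectively. Then $T:=T_n\circ\ldots \circ T_1$ is super strongly nonexpansive with modulus $\chi_{\chi_1,\ldots,\chi_n}$.
   Context: A mapping $T:X\to X$ is super strongly nonexpansive with modulus $\chi:(0,\infty)\to(0,\infty)$ if $\chi$ is an SSNE-modulus for $T$: for any $\varepsilon>0$ and $x,y\in X$ with $\|x-y\|^2-\|Tx-Ty\|^2<\chi(\varepsilon)$, we have $\|(x-y)-(Tx-Ty)\|<\varepsilon$. (Existence of such a $\chi$ is equivalent to $T$ being super strongly nonexpansive: $T$ is nonexpansive, i.e. $\|Tx-Ty\|\le\|x-y\|$ for all $x,y\in X$, and, whenever $(x_n),(y_n)\subseteq X$ with $\|x_n-y_n\|^2-\|Tx_n-Ty_n\|^2\to0$, then $(x_n-y_n)-(Tx_n-Ty_n)\to0$.) *)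

theory Defs
  imports Complex_Main
begin

text \<open>
  A function from the positive reals to the positive reals is rendered as a function on
  \<^typ>\<open>real\<close> of which only the values at positive arguments are ever constrained or used.
\<close>

definition positive_function :: "(real \<Rightarrow> real) \<Rightarrow> bool" where
  "positive_function \<chi> \<longleftrightarrow> (\<forall>\<epsilon>>0. \<chi> \<epsilon> > 0)"

text \<open>
  The type requirement on the modulus is part of the definition. Nonexpansivity of \<open>T\<close> is
  not a separate conjunct: if \<open>norm (T x - T y) > norm (x - y)\<close>, the premise holds for every
  \<open>\<epsilon>\<close>, which forces \<open>T x - T y = x - y\<close>.
\<close>

definition super_strongly_nonexpansive_with_modulus ::
  "('a::real_normed_vector \<Rightarrow> 'a) \<Rightarrow> (real \<Rightarrow> real) \<Rightarrow> bool" where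
  "super_strongly_nonexpansive_with_modulus T \<chi> \<longleftrightarrow>
     positive_function \<chi> \<and>
     (\<forall>\<epsilon>>0. \<forall>x y. (norm (x - y))\<^sup>2 - (norm (T x - T y))\<^sup>2 < \<chi> \<epsilon> \<longrightarrow>
        norm ((x - y) - (T x - T y)) < \<epsilon>)"

definition composition_modulus :: "nat \<Rightarrow> (nat \<Rightarrow> real \<Rightarrow> real) \<Rightarrow> real \<Rightarrow> real" where
  "composition_modulus n \<chi> \<epsilon> = Min {\<chi> i (\<epsilon> / real n) |i. 1 \<le> i \<and> i \<le> n}"

text \<open>\<open>T\<^sub>n \<circ> \<dots> \<circ> T\<^sub>1\<close>, with \<open>T\<^sub>1\<close> applied first.\<close>

primrec composition_upto :: "(nat \<Rightarrow> 'a \<Rightarrow> 'a) \<Rightarrow> nat \<Rightarrow> 'a \<Rightarrow> 'a" where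
  "composition_upto T 0 = id"
| "composition_upto T (Suc n) = T (Suc n) \<circ> composition_upto T n"

end

theory Submission
  imports Defs
begin

text \<open>
  Put \<open>d\<^sub>i = S\<^sub>i x - S\<^sub>i y\<close> with \<open>S\<^sub>i = T\<^sub>i \<circ> \<dots> \<circ> T\<^sub>1\<close>. Each \<open>T\<^sub>i\<close> is nonexpansive, so the decrements
  of \<open>norm d\<^sub>i ^ 2\<close> are nonnegative and each of them is at most their sum
  \<open>norm d\<^sub>0 ^ 2 - norm d\<^sub>n ^ 2\<close>. If this is below every \<open>\<chi>\<^sub>i (\<epsilon> / n)\<close>, then
  \<open>norm (d\<^sub>i\<^sub>-\<^sub>1 - d\<^sub>i) < \<epsilon> / n\<close> for every \<open>i\<close>, and the triangle inequality gives
  \<open>norm (d\<^sub>0 - d\<^sub>n) < \<epsilon>\<close>.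
\<close>

lemma super_strongly_nonexpansive_imp_nonexpansive:
  assumes "super_strongly_nonexpansive_with_modulus T \<chi>"
  shows "norm (T x - T y) \<le> norm (x - y)"
proof (rule ccontr)
  assume expands: "\<not> norm (T x - T y) \<le> norm (x - y)"
  \<comment> \<open>By the reverse triangle inequality this gap bounds the displacement from below,
    so the modulus property at this single \<epsilon> is already contradictory.\<close>
  define \<epsilon> where "\<epsilon> = norm (T x - T y) - norm (x - y)"
  have "\<epsilon> > 0" using expands by (simp add: \<epsilon>_def)
  moreover have "(norm (x - y))\<^sup>2 - (norm (T x - T y))\<^sup>2 \<le> 0"
    using expands by simp
  ultimately have "norm ((x - y) - (T x - T y)) < \<epsilon>"
    using assms unfolding super_strongly_nonexpansive_with_modulus_def positive_function_def
    by (meson le_less_trans)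
  moreover have "\<epsilon> \<le> norm ((x - y) - (T x - T y))"
    unfolding \<epsilon>_def by (metis norm_minus_commute norm_triangle_ineq2)
  ultimately show False by simp
qed

text \<open>Applied with \<open>c = 0\<close> for positivity of the modulus and with
  \<open>c\<close> the total decrement of squared norms.\<close>

lemma composition_modulus_greater_iff:
  assumes "n \<ge> 1"
  shows "c < composition_modulus n \<chi> \<epsilon> \<longleftrightarrow> (\<forall>i\<in>{1..n}. c < \<chi> i (\<epsilon> / real n))"
proof -
  have "{\<chi> i (\<epsilon> / real n) |i. 1 \<le> i \<and> i \<le> n} = (\<lambda>i. \<chi> i (\<epsilon> / real n)) ` {1..n}"
    by auto
  with assms show ?thesis by (simp add: composition_modulus_def)
qed

theorem proposition2p16:
  fixes n :: nat
    and \<chi> :: "nat \<Rightarrow> real \<Rightarrow> real"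
    and T :: "nat \<Rightarrow> 'a::banach \<Rightarrow> 'a"
  assumes "n \<ge> 1"
    and "\<And>i. 1 \<le> i \<Longrightarrow> i \<le> n \<Longrightarrow> positive_function (\<chi> i)"
    and "\<And>i. 1 \<le> i \<Longrightarrow> i \<le> n \<Longrightarrow> super_strongly_nonexpansive_with_modulus (T i) (\<chi> i)"
  shows "super_strongly_nonexpansive_with_modulus (composition_upto T n) (composition_modulus n \<chi>)"
  unfolding super_strongly_nonexpansive_with_modulus_def
proof (intro conjI allI impI)
  show "positive_function (composition_modulus n \<chi>)"
    using assms(1,2) by (simp add: positive_function_def composition_modulus_greater_iff)
next
  fix \<epsilon> :: real and x y :: 'a
  assume "\<epsilon> > 0"
    and small: "(norm (x - y))\<^sup>2 - (norm (composition_upto T n x - composition_upto T n y))\<^sup>2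
      < composition_modulus n \<chi> \<epsilon>"
  define d where "d i = composition_upto T i x - composition_upto T i y" for i
  \<comment> \<open>The passage from \<open>d i\<close> to \<open>d (Suc i)\<close> is made by
    \<open>T (Suc i)\<close>, so \<open>i < n\<close> matches the moduli with indices 1 to
    \<open>n\<close>.\<close>
  have decreasing: "0 \<le> (norm (d i))\<^sup>2 - (norm (d (Suc i)))\<^sup>2" if "i < n" for i
    using super_strongly_nonexpansive_imp_nonexpansive[OF assms(3)[of "Suc i"]] that
    by (simp add: d_def power_mono)
  have step: "norm (d i - d (Suc i)) < \<epsilon> / real n" if "i < n" for i
  proof -
    have "(norm (d i))\<^sup>2 - (norm (d (Suc i)))\<^sup>2
        \<le> (\<Sum>j<n. (norm (d j))\<^sup>2 - (norm (d (Suc j)))\<^sup>2)"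
      using that decreasing
      by (intro member_le_sum[of i "{..<n}" "\<lambda>j. (norm (d j))\<^sup>2 - (norm (d (Suc j)))\<^sup>2"]) auto
    also have "\<dots> = (norm (d 0))\<^sup>2 - (norm (d n))\<^sup>2"
      by (rule sum_lessThan_telescope')
    also have "\<dots> < \<chi> (Suc i) (\<epsilon> / real n)"
      using small that assms(1) by (simp add: composition_modulus_greater_iff d_def)
    finally have "(norm (d i))\<^sup>2 - (norm (d (Suc i)))\<^sup>2 < \<chi> (Suc i) (\<epsilon> / real n)" .
    moreover have "\<epsilon> / real n > 0" using \<open>\<epsilon> > 0\<close> assms(1) by simp
    ultimately show ?thesis
      using assms(3)[of "Suc i"] that
      by (simp add: super_strongly_nonexpansive_with_modulus_def d_def)
  qed
  have "norm (d 0 - d n) = norm (\<Sum>i<n. d i - d (Suc i))"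
    by (simp only: sum_lessThan_telescope')
  also have "\<dots> \<le> (\<Sum>i<n. norm (d i - d (Suc i)))"
    by (rule norm_sum)
  \<comment> \<open>Strictness survives summation because \<open>n \<ge> 1\<close> makes the index
    set nonempty.\<close>
  also have "\<dots> < (\<Sum>i<n. \<epsilon> / real n)"
    using step assms(1) by (intro sum_strict_mono) (auto simp: lessThan_empty_iff)
  also have "\<dots> = \<epsilon>" using assms(1) by simp
  finally show "norm ((x - y) - (composition_upto T n x - composition_upto T n y)) < \<epsilon>"
    by (simp add: d_def)
qed

end
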